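(* Let $f\in\mathbf{P}_V(\bar k)$ correspond to the surjection $l:V_{\bar k}\twoheadrightarrow\bar k$, and let $V'\subsetneq V$ be a subspace. Then $f\in\mathcal{P}_{V/V'}(\bar k)$ if and only if $\mathrm{Ker}(l)\cap V=V'$.
   Context: Let $k$ be a finite field, $\bar k$ an algebraic closure, $V$ a $k$-vector space of dimension $n+1\ge2$, $V_{\bar k}=V\otimes_k\bar k\supset V$. $\mathbf{P}_V=\mathrm{Proj}(\mathrm{Sym}\,V)$ represents the functor sending a $k$-scheme $T$ to the set of isomorphism classes of pairs of an invertible sheaf $\mathcal{L}$ on $T$ and a surjection $V\otimes_k\mathcal{O}_T\twoheadrightarrow\mathcal{L}$; thus $\bar k$-points correspond to surjective linear forms $l:V_{\bar k}\to\bar k$ up to $\bar k^\times$. For $W\subsetneq V$, $\mathbf{P}_{V/W}\subset\mathbf{P}_V$ is the closed subscheme defined by the homogeneous ideal $(v\mid v\in W)$, and $\mathcal{P}_{V/V'}=\mathbf{P}_{V/V'}\setminus\bigcup_{V'\subsetneq W\subsetneq V}\mathbf{P}_{V/W}$. *)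

theory Defs
  imports
    "HOL-Algebra.Algebraic_Closure_Type"
    "HOL-Library.Poly_Mapping"
    "HOL-Algebra.QuotRing"
    "HOL-Algebra.Module"
begin

hide_const (open) Multiset.mult Polynomial.smult

section \<open>The field extension\<close>

definition alg_closure_of :: "('k::field \<Rightarrow> 'K::alg_closed_field) \<Rightarrow> bool" where
  "alg_closure_of \<iota> \<longleftrightarrow>
     \<iota> \<in> ring_hom ring_of_type_algebra ring_of_type_algebra \<and>
     (\<forall>x. \<exists>p. p \<noteq> 0 \<and> poly (map_poly \<iota> p) x = 0)"

section \<open>Extension of scalars of a vector space\<close>

text \<open>
  The tensor product of \<open>V\<close> with \<open>K\<close> over \<open>k\<close> is presented as the free \<open>K\<close>-module on the set \<open>V\<close>,
  modulo the \<open>K\<close>-submodule that makes the symbols \<open>k\<close>-linear. The pure tensor of \<open>v\<close> and \<open>a\<close> is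
  the coset of \<open>Poly_Mapping.single v a\<close>.
\<close>

definition tensor_rel ::
    "('k::field \<Rightarrow> 'v::ab_group_add \<Rightarrow> 'v) \<Rightarrow> ('k \<Rightarrow> 'K::field) \<Rightarrow> ('v \<Rightarrow>\<^sub>0 'K) set" where
  "tensor_rel scale \<iota> = Modules.module.span (\<lambda>c. Poly_Mapping.map ((*) c))
     ({Poly_Mapping.single (v + w) 1 - Poly_Mapping.single v 1 - Poly_Mapping.single w 1 | v w. True} \<union>
      {Poly_Mapping.single (scale c v) 1 - Poly_Mapping.single v (\<iota> c) | c v. True})"

definition tensor_class ::
    "('k::field \<Rightarrow> 'v::ab_group_add \<Rightarrow> 'v) \<Rightarrow> ('k \<Rightarrow> 'K::field) \<Rightarrow> ('v \<Rightarrow>\<^sub>0 'K) \<Rightarrow> ('v \<Rightarrow>\<^sub>0 'K) set" where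
  "tensor_class scale \<iota> x = {y. y - x \<in> tensor_rel scale \<iota>}"

text \<open>The fields \<open>mult\<close> and \<open>one\<close> of a module record are not part of the module structure.\<close>

definition tensor_module ::
    "('k::field \<Rightarrow> 'v::ab_group_add \<Rightarrow> 'v) \<Rightarrow> ('k \<Rightarrow> 'K::field) \<Rightarrow> ('K, ('v \<Rightarrow>\<^sub>0 'K) set) module" where
  "tensor_module scale \<iota> =
     \<lparr>carrier = range (tensor_class scale \<iota>),
      mult = undefined, one = undefined,
      zero = tensor_class scale \<iota> 0,
      add = (\<lambda>A B. \<Union>a\<in>A. \<Union>b\<in>B. tensor_class scale \<iota> (a + b)),
      smult = (\<lambda>c A. \<Union>a\<in>A. tensor_class scale \<iota> (Poly_Mapping.map ((*) c) a))\<rparr>"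

definition tensor_incl ::
    "('k::field \<Rightarrow> 'v::ab_group_add \<Rightarrow> 'v) \<Rightarrow> ('k \<Rightarrow> 'K::field) \<Rightarrow> 'v \<Rightarrow> ('v \<Rightarrow>\<^sub>0 'K) set" where
  "tensor_incl scale \<iota> v = tensor_class scale \<iota> (Poly_Mapping.single v 1)"

definition linear_form :: "('K::field, 'm) module \<Rightarrow> ('m \<Rightarrow> 'K) \<Rightarrow> bool" where
  "linear_form M l \<longleftrightarrow>
     (\<forall>x\<in>carrier M. \<forall>y\<in>carrier M. l (x \<oplus>\<^bsub>M\<^esub> y) = l x + l y) \<and>
     (\<forall>c. \<forall>x\<in>carrier M. l (c \<odot>\<^bsub>M\<^esub> x) = c * l x)"

section \<open>The symmetric algebra\<close>

text \<open>
  \<open>Sym V\<close> is the polynomial ring over \<open>k\<close> with one variable for each vector of \<open>V\<close>, modulo the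
  relations that make the variables \<open>k\<close>-linear. The relations are homogeneous of degree one, so
  the degree of polynomials induces the grading of \<open>Sym V\<close>.
\<close>

definition var :: "'v \<Rightarrow> ('v \<Rightarrow>\<^sub>0 nat) \<Rightarrow>\<^sub>0 'k::comm_ring_1" where
  "var v = Poly_Mapping.single (Poly_Mapping.single v 1) 1"

definition const :: "'k \<Rightarrow> ('v \<Rightarrow>\<^sub>0 nat) \<Rightarrow>\<^sub>0 'k::comm_ring_1" where
  "const c = Poly_Mapping.single 0 c"

definition homogeneous_poly :: "nat \<Rightarrow> (('v \<Rightarrow>\<^sub>0 nat) \<Rightarrow>\<^sub>0 'k::comm_ring_1) \<Rightarrow> bool" where
  "homogeneous_poly d p \<longleftrightarrow>
     (\<forall>m \<in> Poly_Mapping.keys p. (\<Sum>v\<in>Poly_Mapping.keys m. Poly_Mapping.lookup m v) = d)"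

definition sym_rel ::
    "('k::field \<Rightarrow> 'v::ab_group_add \<Rightarrow> 'v) \<Rightarrow> (('v \<Rightarrow>\<^sub>0 nat) \<Rightarrow>\<^sub>0 'k) set" where
  "sym_rel scale = Idl\<^bsub>ring_of_type_algebra\<^esub>
     ({var (v + w) - var v - var w | v w. True} \<union> {var (scale c v) - const c * var v | c v. True})"

definition Sym ::
    "('k::field \<Rightarrow> 'v::ab_group_add \<Rightarrow> 'v) \<Rightarrow> (('v \<Rightarrow>\<^sub>0 nat) \<Rightarrow>\<^sub>0 'k) set ring" where
  "Sym scale = ring_of_type_algebra Quot sym_rel scale"

definition sym_class ::
    "('k::field \<Rightarrow> 'v::ab_group_add \<Rightarrow> 'v) \<Rightarrow> (('v \<Rightarrow>\<^sub>0 nat) \<Rightarrow>\<^sub>0 'k) \<Rightarrow> (('v \<Rightarrow>\<^sub>0 nat) \<Rightarrow>\<^sub>0 'k) set" where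
  "sym_class scale p = sym_rel scale +>\<^bsub>ring_of_type_algebra\<^esub> p"

definition sym_grade ::
    "('k::field \<Rightarrow> 'v::ab_group_add \<Rightarrow> 'v) \<Rightarrow> nat \<Rightarrow> (('v \<Rightarrow>\<^sub>0 nat) \<Rightarrow>\<^sub>0 'k) set set" where
  "sym_grade scale d = sym_class scale ` {p. homogeneous_poly d p}"

definition sym_incl ::
    "('k::field \<Rightarrow> 'v::ab_group_add \<Rightarrow> 'v) \<Rightarrow> 'v \<Rightarrow> (('v \<Rightarrow>\<^sub>0 nat) \<Rightarrow>\<^sub>0 'k) set" where
  "sym_incl scale v = sym_class scale (var v)"

definition sym_const ::
    "('k::field \<Rightarrow> 'v::ab_group_add \<Rightarrow> 'v) \<Rightarrow> 'k \<Rightarrow> (('v \<Rightarrow>\<^sub>0 nat) \<Rightarrow>\<^sub>0 'k) set" where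
  "sym_const scale c = sym_class scale (const c)"

section \<open>Proj of a graded ring\<close>

text \<open>Throughout, \<open>G d\<close> is the homogeneous part of degree \<open>d\<close> of the commutative ring \<open>S\<close>.\<close>

definition homogeneous_ideal :: "('s, 'b) ring_scheme \<Rightarrow> (nat \<Rightarrow> 's set) \<Rightarrow> 's set \<Rightarrow> bool" where
  "homogeneous_ideal S G I \<longleftrightarrow> ideal I S \<and> I = Idl\<^bsub>S\<^esub> (I \<inter> (\<Union>d. G d))"

definition irrelevant_ideal :: "('s, 'b) ring_scheme \<Rightarrow> (nat \<Rightarrow> 's set) \<Rightarrow> 's set" where
  "irrelevant_ideal S G = Idl\<^bsub>S\<^esub> (\<Union>d\<in>{0<..}. G d)"

definition Proj :: "('s, 'b) ring_scheme \<Rightarrow> (nat \<Rightarrow> 's set) \<Rightarrow> 's set set" where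
  "Proj S G = {p. primeideal p S \<and> homogeneous_ideal S G p \<and> \<not> irrelevant_ideal S G \<subseteq> p}"

definition vanishing_locus :: "('s, 'b) ring_scheme \<Rightarrow> (nat \<Rightarrow> 's set) \<Rightarrow> 's set \<Rightarrow> 's set set" where
  "vanishing_locus S G I = {p \<in> Proj S G. I \<subseteq> p}"

text \<open>
  The stalk at \<open>p\<close> of the sheaf \<open>\<O>(e)\<close> on \<open>Proj S\<close> is the degree \<open>e\<close> part of the localization of \<open>S\<close>
  at the homogeneous elements outside \<open>p\<close>. \<open>hom_frac S G p e a b\<close> is the fraction \<open>a / b\<close>, as an
  equivalence class of numerator-denominator pairs.
\<close>

definition frac_pairs ::
    "(nat \<Rightarrow> 's set) \<Rightarrow> 's set \<Rightarrow> nat \<Rightarrow> ('s \<times> 's) set" where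
  "frac_pairs G p e = {(a, b). \<exists>d. a \<in> G (d + e) \<and> b \<in> G d \<and> b \<notin> p}"

definition hom_frac ::
    "('s, 'b) ring_scheme \<Rightarrow> (nat \<Rightarrow> 's set) \<Rightarrow> 's set \<Rightarrow> nat \<Rightarrow> 's \<Rightarrow> 's \<Rightarrow> ('s \<times> 's) set" where
  "hom_frac S G p e a b =
     {(a', b') \<in> frac_pairs G p e.
        \<exists>h \<in> (\<Union>d. G d) - p. h \<otimes>\<^bsub>S\<^esub> (a \<otimes>\<^bsub>S\<^esub> b') = h \<otimes>\<^bsub>S\<^esub> (a' \<otimes>\<^bsub>S\<^esub> b)}"

definition frac_add ::
    "('s, 'b) ring_scheme \<Rightarrow> (nat \<Rightarrow> 's set) \<Rightarrow> 's set \<Rightarrow> nat \<Rightarrow>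
     ('s \<times> 's) set \<Rightarrow> ('s \<times> 's) set \<Rightarrow> ('s \<times> 's) set" where
  "frac_add S G p e A B =
     (\<Union>(a, b)\<in>A. \<Union>(c, d)\<in>B. hom_frac S G p e (a \<otimes>\<^bsub>S\<^esub> d \<oplus>\<^bsub>S\<^esub> c \<otimes>\<^bsub>S\<^esub> b) (b \<otimes>\<^bsub>S\<^esub> d))"

definition frac_mult ::
    "('s, 'b) ring_scheme \<Rightarrow> (nat \<Rightarrow> 's set) \<Rightarrow> 's set \<Rightarrow> nat \<Rightarrow>
     ('s \<times> 's) set \<Rightarrow> ('s \<times> 's) set \<Rightarrow> ('s \<times> 's) set" where
  "frac_mult S G p e A B =
     (\<Union>(a, b)\<in>A. \<Union>(c, d)\<in>B. hom_frac S G p e (a \<otimes>\<^bsub>S\<^esub> c) (b \<otimes>\<^bsub>S\<^esub> d))"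

definition local_ring ::
    "('s, 'b) ring_scheme \<Rightarrow> (nat \<Rightarrow> 's set) \<Rightarrow> 's set \<Rightarrow> ('s \<times> 's) set ring" where
  "local_ring S G p =
     \<lparr>carrier = (\<lambda>(a, b). hom_frac S G p 0 a b) ` frac_pairs G p 0,
      mult = frac_mult S G p 0,
      one = hom_frac S G p 0 \<one>\<^bsub>S\<^esub> \<one>\<^bsub>S\<^esub>,
      zero = hom_frac S G p 0 \<zero>\<^bsub>S\<^esub> \<one>\<^bsub>S\<^esub>,
      add = frac_add S G p 0\<rparr>"

definition twist_stalk ::
    "('s, 'b) ring_scheme \<Rightarrow> (nat \<Rightarrow> 's set) \<Rightarrow> 's set \<Rightarrow> nat \<Rightarrow>
     (('s \<times> 's) set, ('s \<times> 's) set) module" where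
  "twist_stalk S G p e =
     \<lparr>carrier = (\<lambda>(a, b). hom_frac S G p e a b) ` frac_pairs G p e,
      mult = undefined, one = undefined,
      zero = hom_frac S G p e \<zero>\<^bsub>S\<^esub> \<one>\<^bsub>S\<^esub>,
      add = frac_add S G p e,
      smult = frac_mult S G p e\<rparr>"

text \<open>
  A morphism of \<open>k\<close>-schemes from \<open>Spec K\<close>, for a field \<open>K\<close>, to \<open>Proj S\<close> consists of the image
  point \<open>p\<close> and a local homomorphism of \<open>k\<close>-algebras from the local ring at \<open>p\<close> to \<open>K\<close>.
  Here \<open>s\<close> and \<open>\<iota>\<close> are the structure maps of \<open>k\<close> into \<open>S\<close> and \<open>K\<close>.
\<close>

type_synonym ('s, 'K) geom_point = "'s set \<times> (('s \<times> 's) set \<Rightarrow> 'K)"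

definition Proj_points ::
    "('s, 'b) ring_scheme \<Rightarrow> (nat \<Rightarrow> 's set) \<Rightarrow> ('k \<Rightarrow> 's) \<Rightarrow> ('k::field \<Rightarrow> 'K::field) \<Rightarrow>
     ('s, 'K) geom_point set" where
  "Proj_points S G s \<iota> =
     {(p, \<phi>). p \<in> Proj S G \<and>
        \<phi> \<in> ring_hom (local_ring S G p) ring_of_type_algebra \<and>
        (\<forall>x \<in> carrier (local_ring S G p).
           \<phi> x \<in> Units ring_of_type_algebra \<longrightarrow> x \<in> Units (local_ring S G p)) \<and>
        (\<forall>c. \<phi> (hom_frac S G p 0 (s c) \<one>\<^bsub>S\<^esub>) = \<iota> c)}"

text \<open>
  Such a morphism factors through the closed subscheme defined by a homogeneous ideal \<open>I\<close> if and
  only if \<open>p\<close> lies in the underlying closed set and the stalk at \<open>p\<close> of the ideal sheaf of \<open>I\<close> is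
  mapped to zero.
\<close>

definition closed_subscheme_points ::
    "('s, 'b) ring_scheme \<Rightarrow> (nat \<Rightarrow> 's set) \<Rightarrow> ('k \<Rightarrow> 's) \<Rightarrow> ('k::field \<Rightarrow> 'K::field) \<Rightarrow> 's set \<Rightarrow>
     ('s, 'K) geom_point set" where
  "closed_subscheme_points S G s \<iota> I =
     {(p, \<phi>) \<in> Proj_points S G s \<iota>. p \<in> vanishing_locus S G I \<and>
        (\<forall>(a, b) \<in> frac_pairs G p 0. a \<in> I \<longrightarrow> \<phi> (hom_frac S G p 0 a b) = 0)}"

section \<open>The projective space of a vector space and its strata\<close>

definition PV_points ::
    "('k::field \<Rightarrow> 'v::ab_group_add \<Rightarrow> 'v) \<Rightarrow> ('k \<Rightarrow> 'K::field) \<Rightarrow>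
     ((('v \<Rightarrow>\<^sub>0 nat) \<Rightarrow>\<^sub>0 'k) set, 'K) geom_point set" where
  "PV_points scale \<iota> = Proj_points (Sym scale) (sym_grade scale) (sym_const scale) \<iota>"

definition linear_ideal ::
    "('k::field \<Rightarrow> 'v::ab_group_add \<Rightarrow> 'v) \<Rightarrow> 'v set \<Rightarrow> (('v \<Rightarrow>\<^sub>0 nat) \<Rightarrow>\<^sub>0 'k) set set" where
  "linear_ideal scale W = Idl\<^bsub>Sym scale\<^esub> (sym_incl scale ` W)"

text \<open>
  The points of the open subscheme of \<open>P_{V/V'}\<close> that is the complement of the closed subschemes
  \<open>P_{V/W}\<close> are the points of \<open>P_{V/V'}\<close> whose image point lies on none of the \<open>P_{V/W}\<close>.
\<close>

definition stratum_points ::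
    "('k::field \<Rightarrow> 'v::ab_group_add \<Rightarrow> 'v) \<Rightarrow> ('k \<Rightarrow> 'K::field) \<Rightarrow> 'v set \<Rightarrow>
     ((('v \<Rightarrow>\<^sub>0 nat) \<Rightarrow>\<^sub>0 'k) set, 'K) geom_point set" where
  "stratum_points scale \<iota> V' =
     {(p, \<phi>) \<in> closed_subscheme_points (Sym scale) (sym_grade scale) (sym_const scale) \<iota>
                 (linear_ideal scale V').
        p \<notin> (\<Union>W \<in> {W. Modules.module.subspace scale W \<and> V' \<subset> W \<and> W \<subset> UNIV}.
               vanishing_locus (Sym scale) (sym_grade scale) (linear_ideal scale W))}"

text \<open>
  The universal quotient on the projective space of \<open>V\<close> is the map to \<open>\<O>(1)\<close> that sends \<open>v\<close> to the
  global section \<open>v / 1\<close>. Its pullback along \<open>(p, \<phi>)\<close> is isomorphic to \<open>l\<close> if and only if there is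
  an isomorphism from the base change along \<open>\<phi>\<close> of the stalk of \<open>\<O>(1)\<close> at \<open>p\<close> to \<open>K\<close> carrying each
  \<open>v / 1\<close> to \<open>l v\<close>. Homomorphisms from the base change are the \<open>\<phi>\<close>-semilinear maps \<open>\<psi>\<close> below. If \<open>l\<close>
  is surjective, then \<open>\<psi>\<close> automatically induces an isomorphism, as the base change has dimension one.
\<close>

definition corresponds ::
    "('k::field \<Rightarrow> 'v::ab_group_add \<Rightarrow> 'v) \<Rightarrow> ('k \<Rightarrow> 'K::field) \<Rightarrow>
     ((('v \<Rightarrow>\<^sub>0 nat) \<Rightarrow>\<^sub>0 'k) set, 'K) geom_point \<Rightarrow> (('v \<Rightarrow>\<^sub>0 'K) set \<Rightarrow> 'K) \<Rightarrow> bool" where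
  "corresponds scale \<iota> f l \<longleftrightarrow> (case f of (p, \<phi>) \<Rightarrow>
     let S = Sym scale; G = sym_grade scale; L = twist_stalk S G p 1 in
     \<exists>\<psi>. (\<forall>x\<in>carrier L. \<forall>y\<in>carrier L. \<psi> (x \<oplus>\<^bsub>L\<^esub> y) = \<psi> x + \<psi> y) \<and>
         (\<forall>r\<in>carrier (local_ring S G p). \<forall>x\<in>carrier L. \<psi> (r \<odot>\<^bsub>L\<^esub> x) = \<phi> r * \<psi> x) \<and>
         (\<forall>v. \<psi> (hom_frac S G p 1 (sym_incl scale v) \<one>\<^bsub>S\<^esub>) = l (tensor_incl scale \<iota> v)))"

end

theory Submission
  imports Defs
begin

text \<open>
  Everything follows from the equivalence \<open>v \<in> p \<longleftrightarrow> l v = 0\<close> for \<open>v \<in> V\<close>. If \<open>w \<in> V\<close> lies outside \<open>p\<close>,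
  then \<open>v / 1 = (v / w) \<cdot> (w / 1)\<close> in the stalk of \<open>\<O>(1)\<close>, hence \<open>l v = \<phi> (v / w) * l w\<close>. Such a \<open>w\<close>
  exists because \<open>p\<close> does not contain the irrelevant ideal, and \<open>v \<in> p\<close> makes \<open>v / w\<close> a non-unit,
  which the local homomorphism \<open>\<phi>\<close> kills. Conversely, if \<open>l v = 0\<close> but \<open>v \<notin> p\<close>, the same formula with
  \<open>v\<close> as denominator gives \<open>l = 0\<close> on \<open>V\<close>, so \<open>l = 0\<close>, contradicting surjectivity. With
  \<open>V\<^sub>0 = V \<inter> p = V \<inter> Ker l\<close>, a proper subspace, the point lies on \<open>P_{V/W}\<close> iff \<open>W \<subseteq> V\<^sub>0\<close>; hence it
  lies in the stratum of \<open>V'\<close> iff \<open>V' \<subseteq> V\<^sub>0\<close> and \<open>V\<^sub>0\<close> itself is not one of the excluded \<open>W\<close>.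
\<close>

section \<open>Fractions of a graded ring\<close>

text \<open>The fraction calculus rests on two facts about the pieces \<open>G d\<close> of
  \<open>S\<close>: the unit has degree zero, and degrees add under multiplication. No direct sum
  decomposition has to be constructed.\<close>

locale graded_prime = primeideal P S for P and S (structure) +
  fixes G :: "nat \<Rightarrow> 'a set"
  assumes grade_carrier: "G d \<subseteq> carrier S"
    and one_grade: "\<one> \<in> G 0"
    and mult_grade: "a \<in> G d \<Longrightarrow> b \<in> G e \<Longrightarrow> a \<otimes> b \<in> G (d + e)"
begin

definition homs where "homs = (\<Union>d. G d) - P"

lemma homs_mult: "a \<in> homs \<Longrightarrow> b \<in> homs \<Longrightarrow> a \<otimes> b \<in> homs"
  unfolding homs_def using mult_grade I_prime grade_carrier by blast

lemma homs_carrier: "a \<in> homs \<Longrightarrow> a \<in> carrier S"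
  unfolding homs_def using grade_carrier by blast

lemma one_homs: "\<one> \<in> homs"
  unfolding homs_def using one_grade I_notcarr one_imp_carrier by blast

lemma frac_pairsD:
  assumes "(a, b) \<in> frac_pairs G P e"
  shows "a \<in> carrier S" "b \<in> homs" "b \<in> carrier S"
  using assms grade_carrier unfolding frac_pairs_def homs_def by blast+

lemma mem_hom_frac:
  "(a', b') \<in> hom_frac S G P e a b \<longleftrightarrow>
    (a', b') \<in> frac_pairs G P e \<and> (\<exists>h\<in>homs. h \<otimes> (a \<otimes> b') = h \<otimes> (a' \<otimes> b))"
  by (auto simp: hom_frac_def homs_def)

lemma hom_frac_refl: "(a, b) \<in> frac_pairs G P e \<Longrightarrow> (a, b) \<in> hom_frac S G P e a b"
  unfolding mem_hom_frac using one_homs by blast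

text \<open>Transitivity of equality of fractions: \<open>a / b = x / y\<close> and
  \<open>a / b = a' / b'\<close> give \<open>a' / b' = x / y\<close>. The assumptions are symmetric
  in the two fractions, so one inclusion is enough.\<close>

lemma hom_frac_subset:
  assumes "a \<in> carrier S" "b \<in> homs" "a' \<in> carrier S" "b' \<in> homs"
    and "h \<in> homs" "h \<otimes> (a \<otimes> b') = h \<otimes> (a' \<otimes> b)"
  shows "hom_frac S G P e a b \<subseteq> hom_frac S G P e a' b'"
proof (rule subrelI)
  fix x y
  assume "(x, y) \<in> hom_frac S G P e a b"
  then obtain h' where xy: "(x, y) \<in> frac_pairs G P e"
    and h': "h' \<in> homs" "h' \<otimes> (a \<otimes> y) = h' \<otimes> (x \<otimes> b)"
    unfolding mem_hom_frac by blast
  note c = assms(1,3) assms(2,4,5)[THEN homs_carrier] frac_pairsD[OF xy] h'(1)[THEN homs_carrier]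
  \<comment> \<open>Besides the two witnesses, the new one contains the middle denominator
    \<open>b\<close>, which links the two equations. It is admissible because \<open>b\<close> is
    homogeneous and outside \<open>P\<close>.\<close>
  have "(h \<otimes> h' \<otimes> b) \<otimes> (a' \<otimes> y) = h' \<otimes> y \<otimes> (h \<otimes> (a' \<otimes> b))"
    using c by (simp add: m_ac)
  also have "\<dots> = h \<otimes> b' \<otimes> (h' \<otimes> (a \<otimes> y))"
    unfolding assms(6)[symmetric] using c by (simp add: m_ac)
  also have "\<dots> = (h \<otimes> h' \<otimes> b) \<otimes> (x \<otimes> b')"
    unfolding h'(2) using c by (simp add: m_ac)
  finally show "(x, y) \<in> hom_frac S G P e a' b'"
    unfolding mem_hom_frac using xy assms h' homs_mult by blast
qed

lemma hom_frac_eqI: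
  assumes "a \<in> carrier S" "b \<in> homs" "a' \<in> carrier S" "b' \<in> homs"
    and "h \<in> homs" "h \<otimes> (a \<otimes> b') = h \<otimes> (a' \<otimes> b)"
  shows "hom_frac S G P e a b = hom_frac S G P e a' b'"
  using hom_frac_subset[OF assms] hom_frac_subset[OF assms(3,4,1,2,5) assms(6)[symmetric]] by blast

text \<open>\<open>frac_mult\<close> is a union over all representatives. Their products define one
  and the same class, so the union collapses. The degree \<open>r\<close> is free:
  \<open>d = e = r = 0\<close> is multiplication in the local ring, while \<open>d = 0\<close> and
  \<open>e = r = 1\<close> is its action on the stalk of \<open>O(1)\<close>.\<close>

lemma frac_mult_hom_frac:
  assumes ab: "(a, b) \<in> frac_pairs G P d" and cd: "(c, d') \<in> frac_pairs G P e"
  shows "frac_mult S G P r (hom_frac S G P d a b) (hom_frac S G P e c d') =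
    hom_frac S G P r (a \<otimes> c) (b \<otimes> d')"
proof -
  have "hom_frac S G P r (x \<otimes> z) (y \<otimes> w) = hom_frac S G P r (a \<otimes> c) (b \<otimes> d')"
    if xy: "(x, y) \<in> hom_frac S G P d a b" and zw: "(z, w) \<in> hom_frac S G P e c d'" for x y z w
  proof -
    obtain h where h: "h \<in> homs" "h \<otimes> (a \<otimes> y) = h \<otimes> (x \<otimes> b)"
      and xy': "(x, y) \<in> frac_pairs G P d"
      using xy unfolding mem_hom_frac by blast
    obtain g where g: "g \<in> homs" "g \<otimes> (c \<otimes> w) = g \<otimes> (z \<otimes> d')"
      and zw': "(z, w) \<in> frac_pairs G P e"
      using zw unfolding mem_hom_frac by blast
    note c = frac_pairsD[OF ab] frac_pairsD[OF cd] frac_pairsD[OF xy'] frac_pairsD[OF zw']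
      h(1)[THEN homs_carrier] g(1)[THEN homs_carrier]
    have "(h \<otimes> g) \<otimes> ((x \<otimes> z) \<otimes> (b \<otimes> d')) = (h \<otimes> (x \<otimes> b)) \<otimes> (g \<otimes> (z \<otimes> d'))"
      using c by (simp add: m_ac)
    also have "\<dots> = (h \<otimes> g) \<otimes> ((a \<otimes> c) \<otimes> (y \<otimes> w))"
      unfolding h(2)[symmetric] g(2)[symmetric] using c by (simp add: m_ac)
    finally show ?thesis
      using c h(1) g(1) by (intro hom_frac_eqI[where h = "h \<otimes> g"] homs_mult) auto
  qed
  note const = this
  have "(\<Union>(z, w)\<in>hom_frac S G P e c d'. hom_frac S G P r (x \<otimes> z) (y \<otimes> w)) =
      hom_frac S G P r (a \<otimes> c) (b \<otimes> d')"
    if "(x, y) \<in> hom_frac S G P d a b" for x y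
    by (rule SUP_eq_const) (use const[OF that] hom_frac_refl[OF cd] in auto)
  then show ?thesis
    unfolding frac_mult_def by (intro SUP_eq_const) (use hom_frac_refl[OF ab] in auto)
qed

lemma hom_frac_in_local_ring:
  "(a, b) \<in> frac_pairs G P 0 \<Longrightarrow> hom_frac S G P 0 a b \<in> carrier (local_ring S G P)"
  unfolding local_ring_def by force

lemma hom_frac_in_twist_stalk:
  "(a, b) \<in> frac_pairs G P e \<Longrightarrow> hom_frac S G P e a b \<in> carrier (twist_stalk S G P e)"
  unfolding twist_stalk_def by force

text \<open>An inverse \<open>c / d\<close> yields an equation \<open>h * a * c = h * b * d\<close>
  with \<open>h\<close>, \<open>b\<close>, \<open>d\<close> homogeneous outside \<open>P\<close>.
  The right side avoids the prime \<open>P\<close>, so \<open>a\<close> cannot lie in it.\<close>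

lemma local_ring_unit_notin:
  assumes ab: "(a, b) \<in> frac_pairs G P 0"
    and unit: "hom_frac S G P 0 a b \<in> Units (local_ring S G P)"
  shows "a \<notin> P"
proof
  assume "a \<in> P"
  from unit obtain y where y: "y \<in> carrier (local_ring S G P)"
    and "hom_frac S G P 0 a b \<otimes>\<^bsub>local_ring S G P\<^esub> y = \<one>\<^bsub>local_ring S G P\<^esub>"
    unfolding Units_def by blast
  moreover from y obtain c d where cd: "(c, d) \<in> frac_pairs G P 0" and "y = hom_frac S G P 0 c d"
    unfolding local_ring_def by auto
  ultimately have "hom_frac S G P 0 (a \<otimes> c) (b \<otimes> d) = hom_frac S G P 0 \<one> \<one>"
    using frac_mult_hom_frac[OF ab cd] by (simp add: local_ring_def)
  moreover have "(\<one>, \<one>) \<in> frac_pairs G P 0"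
    using one_grade one_homs unfolding frac_pairs_def homs_def by auto
  ultimately have "(\<one>, \<one>) \<in> hom_frac S G P 0 (a \<otimes> c) (b \<otimes> d)"
    using hom_frac_refl by blast
  then obtain h where h: "h \<in> homs" "h \<otimes> ((a \<otimes> c) \<otimes> \<one>) = h \<otimes> (\<one> \<otimes> (b \<otimes> d))"
    unfolding mem_hom_frac by blast
  note c = frac_pairsD[OF ab] frac_pairsD[OF cd] h(1)[THEN homs_carrier]
  have "h \<otimes> (b \<otimes> d) = (h \<otimes> c) \<otimes> a"
    using h(2) c by (simp add: m_ac)
  also have "\<dots> \<in> P"
    using \<open>a \<in> P\<close> c by (intro I_l_closed) auto
  finally show False
    using homs_mult[OF h(1) homs_mult[of b d]] c unfolding homs_def by blast
qed

end

section \<open>The symmetric algebra\<close>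

lemma type_algebra_sel [simp]:
  "carrier ring_of_type_algebra = UNIV"
  "\<one>\<^bsub>ring_of_type_algebra\<^esub> = 1"
  "\<zero>\<^bsub>ring_of_type_algebra\<^esub> = 0"
  "x \<otimes>\<^bsub>ring_of_type_algebra\<^esub> y = x * y"
  "x \<oplus>\<^bsub>ring_of_type_algebra\<^esub> y = x + y"
  by (simp_all add: ring_of_type_algebra_def)

lemma poly_mapping_eq_sum_single:
  "x = (\<Sum>k\<in>Poly_Mapping.keys x. Poly_Mapping.single k (Poly_Mapping.lookup x k))"
  by (rule poly_mapping_eqI)
    (simp add: lookup_sum lookup_single when_def in_keys_iff sum.delta cong: if_cong)

lemma ideal_sym_rel: "ideal (sym_rel scale) ring_of_type_algebra"
  unfolding sym_rel_def by (intro ring.genideal_ideal ring_from_type_algebra) simp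

lemma cring_Sym: "cring (Sym scale)"
  unfolding Sym_def by (intro ideal.quotient_is_cring ideal_sym_rel cring_from_type_algebra)

lemma ring_hom_sym_class: "sym_class scale \<in> ring_hom ring_of_type_algebra (Sym scale)"
  using ideal.rcos_ring_hom[OF ideal_sym_rel, of scale]
  by (simp add: Sym_def sym_class_def[abs_def])

lemma sym_class_carrier: "sym_class scale x \<in> carrier (Sym scale)"
  using ring_hom_closed[OF ring_hom_sym_class] by simp

lemma sym_class_add:
  "sym_class scale (x + y) = sym_class scale x \<oplus>\<^bsub>Sym scale\<^esub> sym_class scale y"
  using ring_hom_add[OF ring_hom_sym_class] by simp

lemma sym_class_mult:
  "sym_class scale (x * y) = sym_class scale x \<otimes>\<^bsub>Sym scale\<^esub> sym_class scale y"
  using ring_hom_mult[OF ring_hom_sym_class] by simp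

lemma sym_class_one: "sym_class scale 1 = \<one>\<^bsub>Sym scale\<^esub>"
  using ring_hom_one[OF ring_hom_sym_class, of scale] by simp

lemma sym_class_eqI: "x - y \<in> sym_rel scale \<Longrightarrow> sym_class scale x = sym_class scale y"
proof -
  assume *: "x - y \<in> sym_rel scale"
  interpret ideal "sym_rel scale" ring_of_type_algebra
    by (rule ideal_sym_rel)
  have "x \<in> sym_rel scale +>\<^bsub>ring_of_type_algebra\<^esub> y"
    using * by (force simp: a_r_coset_def r_coset_def intro: bexI[of _ "x - y"])
  then show ?thesis
    unfolding sym_class_def using a_repr_independence'[of x y] by simp
qed

lemma sym_incl_add:
  "sym_incl scale (v + w) = sym_incl scale v \<oplus>\<^bsub>Sym scale\<^esub> sym_incl scale w"
proof -
  have "var (v + w) - (var v + var w) \<in> sym_rel scale"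
    unfolding sym_rel_def
    by (rule subsetD[OF ring.genideal_self[OF ring_from_type_algebra]])
      (auto simp: diff_diff_eq[symmetric])
  then show ?thesis
    unfolding sym_incl_def sym_class_add[symmetric] by (rule sym_class_eqI)
qed

lemma sym_incl_scale:
  "sym_incl scale (scale c v) = sym_const scale c \<otimes>\<^bsub>Sym scale\<^esub> sym_incl scale v"
proof -
  have "var (scale c v) - const c * var v \<in> sym_rel scale"
    unfolding sym_rel_def
    by (rule subsetD[OF ring.genideal_self[OF ring_from_type_algebra]]) auto
  then show ?thesis
    unfolding sym_incl_def sym_const_def sym_class_mult[symmetric] by (rule sym_class_eqI)
qed

section \<open>The grading of the symmetric algebra and its generation in degree one\<close>

lemma sum_keys_add_nat:
  fixes m m' :: "'v \<Rightarrow>\<^sub>0 nat"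
  shows "(\<Sum>v\<in>Poly_Mapping.keys (m + m'). Poly_Mapping.lookup (m + m') v) =
    (\<Sum>v\<in>Poly_Mapping.keys m. Poly_Mapping.lookup m v) +
    (\<Sum>v\<in>Poly_Mapping.keys m'. Poly_Mapping.lookup m' v)"
  using setsum_keys_plus_distrib[of "\<lambda>_ x. x" m m'] by simp

lemma homogeneous_poly_mult:
  assumes "homogeneous_poly d p" "homogeneous_poly e q"
  shows "homogeneous_poly (d + e) (p * q)"
  unfolding homogeneous_poly_def
proof
  fix m assume "m \<in> Poly_Mapping.keys (p * q)"
  then obtain a b where "a \<in> Poly_Mapping.keys p" "b \<in> Poly_Mapping.keys q" "m = a + b"
    using keys_mult[of p q] by blast
  then show "(\<Sum>v\<in>Poly_Mapping.keys m. Poly_Mapping.lookup m v) = d + e"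
    using assms sum_keys_add_nat[of a b] by (simp add: homogeneous_poly_def)
qed

lemma sym_incl_grade: "sym_incl scale v \<in> sym_grade scale 1"
  unfolding sym_incl_def sym_grade_def
  by (rule imageI) (auto simp: homogeneous_poly_def var_def)

lemma graded_prime_Sym:
  assumes "primeideal P (Sym scale)"
  shows "graded_prime P (Sym scale) (sym_grade scale)"
proof (intro graded_prime.intro graded_prime_axioms.intro assms)
  show "sym_grade scale d \<subseteq> carrier (Sym scale)" for d
    unfolding sym_grade_def using sym_class_carrier by blast
  show "\<one>\<^bsub>Sym scale\<^esub> \<in> sym_grade scale 0"
    unfolding sym_grade_def sym_class_one[symmetric]
    by (rule imageI) (auto simp: homogeneous_poly_def simp flip: single_one)
  show "a \<otimes>\<^bsub>Sym scale\<^esub> b \<in> sym_grade scale (d + e)"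
    if "a \<in> sym_grade scale d" "b \<in> sym_grade scale e" for a b d e
    using that unfolding sym_grade_def
    by (auto intro: homogeneous_poly_mult simp flip: sym_class_mult)
qed

text \<open>A monomial of positive degree is divisible by a variable. Contrapositively, every point
  of \<open>Proj\<close> misses some vector of \<open>V\<close>, which supplies a denominator of
  degree one.\<close>

lemma irrelevant_ideal_subset:
  assumes P: "ideal P (Sym scale)" and incl: "range (sym_incl scale) \<subseteq> P"
  shows "irrelevant_ideal (Sym scale) (sym_grade scale) \<subseteq> P"
proof -
  interpret ideal P "Sym scale" by (rule P)
  have zero: "sym_class scale 0 \<in> P"
    using ring_hom_zero[OF ring_hom_sym_class ring_from_type_algebra ring_axioms] by simp
  have "sym_class scale q \<in> P" if q: "homogeneous_poly d q" and d: "0 < d" for q d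
  proof -
    have term_in: "sym_class scale (Poly_Mapping.single m c) \<in> P"
      if m: "m \<in> Poly_Mapping.keys q" for m c
    proof -
      have "(\<Sum>v\<in>Poly_Mapping.keys m. Poly_Mapping.lookup m v) \<noteq> 0"
        using q d m by (auto simp: homogeneous_poly_def)
      then obtain v where v: "v \<in> Poly_Mapping.keys m"
        by (meson sum.not_neutral_contains_not_neutral)
      \<comment> \<open>Subtraction of exponents is truncated, but \<open>v\<close> occurs in
        \<open>m\<close>, so adding the variable back recovers \<open>m\<close>.\<close>
      define m' where "m' = m - Poly_Mapping.single v 1"
      have "m = m' + Poly_Mapping.single v 1"
        using v by (intro poly_mapping_eqI)
          (auto simp: m'_def lookup_add lookup_minus lookup_single when_def in_keys_iff)
      then have "Poly_Mapping.single m c = Poly_Mapping.single m' c * var v"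
        by (simp add: var_def mult_single)
      then show ?thesis
        using incl I_l_closed[OF _ sym_class_carrier]
        by (auto simp: sym_class_mult sym_incl_def image_subset_iff)
    qed
    \<comment> \<open>The induction runs over subsets of the support of \<open>q\<close>, where
      every monomial is known to have degree \<open>d\<close>.\<close>
    have "sym_class scale (\<Sum>m\<in>A. Poly_Mapping.single m (Poly_Mapping.lookup q m)) \<in> P"
      if "A \<subseteq> Poly_Mapping.keys q" "finite A" for A
      using that(2,1)
    proof (induction A)
      case empty
      then show ?case using zero by simp
    next
      case (insert x F)
      then show ?case
        using term_in a_closed by (simp add: sym_class_add)
    qed
    then show ?thesis
      using poly_mapping_eq_sum_single[of q] by (metis finite_keys order_refl)
  qed
  then show ?thesis
    unfolding irrelevant_ideal_def
    by (intro genideal_minimal P) (auto simp: sym_grade_def)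
qed

section \<open>Extension of scalars\<close>

lemma lookup_map_mult [simp]:
  "Poly_Mapping.lookup (Poly_Mapping.map ((*) c) x) k = (c :: 'a :: mult_zero) * Poly_Mapping.lookup x k"
  by (simp add: Poly_Mapping.map.rep_eq when_def)

text \<open>Makes the general closure properties of spans available for
  \<open>tensor_rel\<close>.\<close>

lemma module_poly_mapping:
  "Modules.module (\<lambda>c::'K::comm_ring_1. Poly_Mapping.map ((*) c) :: ('v \<Rightarrow>\<^sub>0 'K) \<Rightarrow> _)"
  by unfold_locales (auto intro!: poly_mapping_eqI simp: lookup_add algebra_simps)

lemma subspace_tensor_rel:
  "Modules.module.subspace (\<lambda>c. Poly_Mapping.map ((*) c)) (tensor_rel scale \<iota>)"
  unfolding tensor_rel_def by (rule module.subspace_span[OF module_poly_mapping])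

lemma tensor_rel_add: "x \<in> tensor_rel scale \<iota> \<Longrightarrow> y \<in> tensor_rel scale \<iota> \<Longrightarrow> x + y \<in> tensor_rel scale \<iota>"
  by (rule module.subspace_add[OF module_poly_mapping subspace_tensor_rel])

lemma tensor_rel_diff: "x \<in> tensor_rel scale \<iota> \<Longrightarrow> y \<in> tensor_rel scale \<iota> \<Longrightarrow> x - y \<in> tensor_rel scale \<iota>"
  by (rule module.subspace_diff[OF module_poly_mapping subspace_tensor_rel])

lemma tensor_rel_scale:
  "x \<in> tensor_rel scale \<iota> \<Longrightarrow> Poly_Mapping.map ((*) c) x \<in> tensor_rel scale \<iota>"
  by (rule module.subspace_scale[OF module_poly_mapping subspace_tensor_rel])

lemma tensor_rel_zero: "0 \<in> tensor_rel scale \<iota>"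
  by (rule module.subspace_0[OF module_poly_mapping subspace_tensor_rel])

lemma tensor_class_self: "x \<in> tensor_class scale \<iota> x"
  by (simp add: tensor_class_def tensor_rel_zero)

lemma tensor_class_eq_iff:
  "tensor_class scale \<iota> x = tensor_class scale \<iota> y \<longleftrightarrow> x - y \<in> tensor_rel scale \<iota>"
proof
  assume "tensor_class scale \<iota> x = tensor_class scale \<iota> y"
  then show "x - y \<in> tensor_rel scale \<iota>"
    using tensor_class_self[of x scale \<iota>] by (auto simp: tensor_class_def)
next
  assume xy: "x - y \<in> tensor_rel scale \<iota>"
  have "z - x \<in> tensor_rel scale \<iota> \<longleftrightarrow> z - y \<in> tensor_rel scale \<iota>" for z
    using tensor_rel_add[OF _ xy, of "z - x"] tensor_rel_diff[OF _ xy, of "z - y"] by auto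
  then show "tensor_class scale \<iota> x = tensor_class scale \<iota> y"
    by (simp add: tensor_class_def)
qed

lemma tensor_module_add:
  "tensor_class scale \<iota> x \<oplus>\<^bsub>tensor_module scale \<iota>\<^esub> tensor_class scale \<iota> y = tensor_class scale \<iota> (x + y)"
proof -
  have "tensor_class scale \<iota> (a + b) = tensor_class scale \<iota> (x + y)"
    if "a \<in> tensor_class scale \<iota> x" "b \<in> tensor_class scale \<iota> y" for a b
    unfolding tensor_class_eq_iff
    using tensor_rel_add[of "a - x" scale \<iota> "b - y"] that
    by (simp add: tensor_class_def algebra_simps)
  then show ?thesis
    unfolding tensor_module_def ring.simps using tensor_class_self by (intro SUP_eq_const) blast+
qed

lemma tensor_module_smult:
  "c \<odot>\<^bsub>tensor_module scale \<iota>\<^esub> tensor_class scale \<iota> x = tensor_class scale \<iota> (Poly_Mapping.map ((*) c) x)"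
proof -
  have "tensor_class scale \<iota> (Poly_Mapping.map ((*) c) a) = tensor_class scale \<iota> (Poly_Mapping.map ((*) c) x)"
    if "a \<in> tensor_class scale \<iota> x" for a
    unfolding tensor_class_eq_iff module.scale_right_diff_distrib[OF module_poly_mapping, symmetric]
    using tensor_rel_scale[of "a - x"] that by (simp add: tensor_class_def)
  then show ?thesis
    unfolding tensor_module_def module.simps using tensor_class_self by (intro SUP_eq_const) blast+
qed

lemma carrier_tensor_module: "carrier (tensor_module scale \<iota>) = range (tensor_class scale \<iota>)"
  by (simp add: tensor_module_def)

lemma tensor_incl_carrier: "tensor_incl scale \<iota> v \<in> carrier (tensor_module scale \<iota>)"
  by (simp add: carrier_tensor_module tensor_incl_def)

text \<open>The pure tensors of the vectors with \<open>1\<close> generate the extended space over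
  \<open>K\<close>. Hence a surjective form cannot vanish on all of \<open>V\<close>.\<close>

lemma linear_form_zero_on_pure_tensors:
  assumes l: "linear_form (tensor_module scale \<iota>) l"
    and zero: "\<And>v. l (tensor_incl scale \<iota> v) = 0"
    and x: "x \<in> carrier (tensor_module scale \<iota>)"
  shows "l x = 0"
proof -
  have add: "l (tensor_class scale \<iota> (a + b)) = l (tensor_class scale \<iota> a) + l (tensor_class scale \<iota> b)"
    for a b
    using l by (auto simp: linear_form_def carrier_tensor_module simp flip: tensor_module_add)
  have single: "l (tensor_class scale \<iota> (Poly_Mapping.single v c)) = 0" for v c
  proof -
    have "Poly_Mapping.single v c = Poly_Mapping.map ((*) c) (Poly_Mapping.single v 1)"
      by (rule poly_mapping_eqI) (simp add: lookup_single when_def)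
    then have "tensor_class scale \<iota> (Poly_Mapping.single v c) =
        c \<odot>\<^bsub>tensor_module scale \<iota>\<^esub> tensor_incl scale \<iota> v"
      by (simp add: tensor_incl_def tensor_module_smult)
    then show ?thesis
      using l zero[of v] tensor_incl_carrier[of scale \<iota> v]
      by (simp add: linear_form_def)
  qed
  obtain y where y: "x = tensor_class scale \<iota> y"
    using x by (auto simp: carrier_tensor_module)
  have "l (tensor_class scale \<iota> (\<Sum>k\<in>A. Poly_Mapping.single k (Poly_Mapping.lookup y k))) = 0"
    if "finite A" for A
    using that
  proof (induction A)
    case empty
    \<comment> \<open>The empty sum is a single symbol with coefficient \<open>0\<close>.\<close>
    then show ?case using single[of _ 0] by simp
  qed (simp add: add single)
  then show ?thesis
    using poly_mapping_eq_sum_single[of y] y by (metis finite_keys)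
qed

text \<open>A map \<open>g\<close> that is linear along \<open>\<iota>\<close> extends to a
  \<open>K\<close>-linear form \<open>E\<close> on the free module, and \<open>E\<close> kills both
  kinds of generating relations. This is the existence half of the universal property of the tensor
  product, used to show that an element is not a relation.\<close>

lemma tensor_rel_annihilated:
  fixes g :: "'v::ab_group_add \<Rightarrow> 'K::field"
  assumes add: "\<And>v w. g (v + w) = g v + g w"
    and scale: "\<And>c v. g (scale c v) = \<iota> c * g v"
    and x: "x \<in> tensor_rel scale \<iota>"
  shows "(\<Sum>k\<in>Poly_Mapping.keys x. Poly_Mapping.lookup x k * g k) = 0"
proof -
  define E where "E x = (\<Sum>k\<in>Poly_Mapping.keys x. Poly_Mapping.lookup x k * g k)" for x :: "'v \<Rightarrow>\<^sub>0 'K"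
  have E_add: "E (x + y) = E x + E y" for x y
    using setsum_keys_plus_distrib[of "\<lambda>k a. a * g k" x y] by (simp add: E_def distrib_right)
  have E_diff: "E (x - y) = E x - E y" for x y
    using E_add[of "x - y" y] by simp
  have E_single: "E (Poly_Mapping.single k c) = c * g k" for k c
    by (simp add: E_def)
  have E_scale: "E (Poly_Mapping.map ((*) c) x) = c * E x" for c x
  proof -
    have "E (Poly_Mapping.map ((*) c) x) =
      (\<Sum>k\<in>Poly_Mapping.keys x. Poly_Mapping.lookup (Poly_Mapping.map ((*) c) x) k * g k)"
      \<comment> \<open>Scaling by \<open>c = 0\<close> shrinks the support; the added terms
        vanish.\<close>
      unfolding E_def by (rule sum.mono_neutral_left) (auto simp: in_keys_iff)
    then show ?thesis
      by (simp add: E_def sum_distrib_left mult.assoc)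
  qed
  have "tensor_rel scale \<iota> \<subseteq> {x. E x = 0}"
    unfolding tensor_rel_def
  proof (rule module.span_minimal[OF module_poly_mapping])
    show "Modules.module.subspace (\<lambda>c. Poly_Mapping.map ((*) c)) {x. E x = 0}"
      by (rule module.subspaceI[OF module_poly_mapping]) (auto simp: E_add E_scale, simp add: E_def)
  qed (auto simp: E_diff E_single add scale)
  then show ?thesis
    using x by (auto simp: E_def)
qed

text \<open>A linear functional with value \<open>1\<close> on \<open>v - w\<close> separates
  \<open>v\<close> from \<open>w\<close> and, composed with \<open>\<iota>\<close>, also separates
  their tensors. This lets subsets of \<open>V\<close> be compared through their images.\<close>

lemma inj_tensor_incl:
  fixes scale :: "'k::field \<Rightarrow> 'v::ab_group_add \<Rightarrow> 'v" and \<iota> :: "'k \<Rightarrow> 'K::field"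
  assumes V: "vector_space scale"
    and \<iota>: "\<iota> \<in> ring_hom ring_of_type_algebra ring_of_type_algebra"
  shows "inj (tensor_incl scale \<iota>)"
proof (rule injI, rule ccontr)
  fix v w
  assume eq: "tensor_incl scale \<iota> v = tensor_incl scale \<iota> w" and "v \<noteq> w"
  interpret vector_space scale by (rule V)
  have ind: "independent {v - w}"
    using \<open>v \<noteq> w\<close> by simp
  define B where "B = extend_basis {v - w}"
  have B: "independent B" "v - w \<in> B" "span B = UNIV"
    using independent_extend_basis[OF ind] extend_basis_superset[OF ind] span_extend_basis[OF ind]
    by (auto simp: B_def)
  have \<iota>_add: "\<iota> (a + b) = \<iota> a + \<iota> b" and \<iota>_mult: "\<iota> (a * b) = \<iota> a * \<iota> b" and \<iota>_one: "\<iota> 1 = 1" for a b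
    using ring_hom_add[OF \<iota>] ring_hom_mult[OF \<iota>] ring_hom_one[OF \<iota>] by simp_all
  \<comment> \<open>The coordinate along the basis vector \<open>v - w\<close>, carried into
    \<open>K\<close>.\<close>
  define g where "g u = \<iota> (representation B u (v - w))" for u
  have g_add: "g (x + y) = g x + g y" for x y
    using B by (simp add: g_def representation_add \<iota>_add)
  have g_scale: "g (scale c x) = \<iota> c * g x" for c x
    using B by (simp add: g_def representation_scale \<iota>_mult)
  have "g (v - w) = 1"
    using B by (simp add: g_def representation_basis \<iota>_one)
  have "Poly_Mapping.single v 1 - Poly_Mapping.single w 1 \<in> tensor_rel scale \<iota>"
    using eq by (simp add: tensor_incl_def tensor_class_eq_iff)
  from tensor_rel_annihilated[of g, OF g_add g_scale this]
  have "(\<Sum>k\<in>Poly_Mapping.keys (Poly_Mapping.single v 1 - Poly_Mapping.single w (1::'K)).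
    Poly_Mapping.lookup (Poly_Mapping.single v 1 - Poly_Mapping.single w 1) k * g k) = 0" .
  \<comment> \<open>Since \<open>v\<close> and \<open>w\<close> differ, nothing cancels, and the sum
    above is \<open>g v - g w\<close>.\<close>
  moreover have "Poly_Mapping.keys (Poly_Mapping.single v 1 - Poly_Mapping.single w (1::'K)) = {v, w}"
    using \<open>v \<noteq> w\<close> by (auto simp: in_keys_iff lookup_minus lookup_single when_def split: if_splits)
  ultimately have "g v = g w"
    using \<open>v \<noteq> w\<close> by (simp add: lookup_minus lookup_single when_def)
  with \<open>g (v - w) = 1\<close> g_add[of "v - w" w] show False
    by simp
qed

section \<open>The strata\<close>

text \<open>Nonzero elements of \<open>K\<close> are units, and \<open>\<phi>\<close> reflects
  units, whereas a fraction with numerator in \<open>p\<close> is no unit. So the ideal sheaf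
  condition for a closed subscheme is automatic once \<open>p\<close> lies on its closed
  set.\<close>

lemma local_hom_eq_0:
  fixes \<phi> :: "_ \<Rightarrow> 'K::field"
  assumes f: "(p, \<phi>) \<in> PV_points scale \<iota>"
    and ab: "(a, b) \<in> frac_pairs (sym_grade scale) p 0" and "a \<in> p"
  shows "\<phi> (hom_frac (Sym scale) (sym_grade scale) p 0 a b) = 0"
proof (rule ccontr)
  let ?x = "hom_frac (Sym scale) (sym_grade scale) p 0 a b"
  interpret graded_prime p "Sym scale" "sym_grade scale"
    using f by (auto simp: PV_points_def Proj_points_def Proj_def intro: graded_prime_Sym)
  assume "\<phi> ?x \<noteq> 0"
  then have "\<phi> ?x \<in> Units ring_of_type_algebra"
    by (auto simp: Units_def intro!: exI[of _ "inverse (\<phi> ?x)"])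
  then have "?x \<in> Units (local_ring (Sym scale) (sym_grade scale) p)"
    using f hom_frac_in_local_ring[OF ab] by (auto simp: PV_points_def Proj_points_def)
  then show False
    using local_ring_unit_notin[OF ab] \<open>a \<in> p\<close> by simp
qed

text \<open>Semilinearity of \<open>\<psi>\<close>, applied to
  \<open>v / 1 = (v / w) (w / 1)\<close>, expresses all values of \<open>l\<close> on
  \<open>V\<close> through \<open>\<phi>\<close> and one value \<open>l w\<close>.\<close>

lemma corresponds_quotient:
  assumes f: "(p, \<phi>) \<in> PV_points scale \<iota>"
    and corr: "corresponds scale \<iota> (p, \<phi>) l"
    and w: "sym_incl scale w \<notin> p"
  shows "l (tensor_incl scale \<iota> v) =
    \<phi> (hom_frac (Sym scale) (sym_grade scale) p 0 (sym_incl scale v) (sym_incl scale w)) *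
    l (tensor_incl scale \<iota> w)"
proof -
  let ?S = "Sym scale" and ?G = "sym_grade scale" and ?i = "sym_incl scale"
  interpret graded_prime p ?S ?G
    using f by (auto simp: PV_points_def Proj_points_def Proj_def intro: graded_prime_Sym)
  obtain \<psi> where
    mult: "\<And>r x. r \<in> carrier (local_ring ?S ?G p) \<Longrightarrow> x \<in> carrier (twist_stalk ?S ?G p 1) \<Longrightarrow>
      \<psi> (r \<odot>\<^bsub>twist_stalk ?S ?G p 1\<^esub> x) = \<phi> r * \<psi> x"
    and incl: "\<And>v. \<psi> (hom_frac ?S ?G p 1 (?i v) \<one>\<^bsub>?S\<^esub>) = l (tensor_incl scale \<iota> v)"
    using corr unfolding corresponds_def Let_def prod.case by blast
  have vw: "(?i v, ?i w) \<in> frac_pairs ?G p 0"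
    using w sym_incl_grade[of scale] by (auto simp: frac_pairs_def)
  have w1: "(?i w, \<one>\<^bsub>?S\<^esub>) \<in> frac_pairs ?G p 1"
    using one_grade one_homs sym_incl_grade[of scale] by (auto simp: frac_pairs_def homs_def)
  note c = frac_pairsD[OF vw] frac_pairsD[OF w1]
  have "hom_frac ?S ?G p 0 (?i v) (?i w) \<odot>\<^bsub>twist_stalk ?S ?G p 1\<^esub> hom_frac ?S ?G p 1 (?i w) \<one>\<^bsub>?S\<^esub> =
      hom_frac ?S ?G p 1 (?i v \<otimes>\<^bsub>?S\<^esub> ?i w) (?i w \<otimes>\<^bsub>?S\<^esub> \<one>\<^bsub>?S\<^esub>)"
    using frac_mult_hom_frac[OF vw w1] by (simp add: twist_stalk_def)
  also have "\<dots> = hom_frac ?S ?G p 1 (?i v) \<one>\<^bsub>?S\<^esub>"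
    using c by (intro hom_frac_eqI[OF _ _ _ _ one_homs]) (auto simp: m_ac)
  finally show ?thesis
    using mult[OF hom_frac_in_local_ring[OF vw] hom_frac_in_twist_stalk[OF w1]] incl by metis
qed

lemma sym_incl_mem_iff:
  fixes scale :: "'k::field \<Rightarrow> 'v::ab_group_add \<Rightarrow> 'v" and \<iota> :: "'k \<Rightarrow> 'K::field"
  assumes f: "(p, \<phi>) \<in> PV_points scale \<iota>"
    and corr: "corresponds scale \<iota> (p, \<phi>) l"
    and l: "linear_form (tensor_module scale \<iota>) l"
    and surj: "l ` carrier (tensor_module scale \<iota>) = UNIV"
  shows "sym_incl scale v \<in> p \<longleftrightarrow> l (tensor_incl scale \<iota> v) = 0"
proof
  have p: "ideal p (Sym scale)" "\<not> irrelevant_ideal (Sym scale) (sym_grade scale) \<subseteq> p"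
    using f by (auto simp: PV_points_def Proj_points_def Proj_def primeideal.axioms)
  assume v: "sym_incl scale v \<in> p"
  obtain w where w: "sym_incl scale w \<notin> p"
    using irrelevant_ideal_subset[OF p(1)] p(2) by blast
  have "(sym_incl scale v, sym_incl scale w) \<in> frac_pairs (sym_grade scale) p 0"
    using w sym_incl_grade[of scale] by (auto simp: frac_pairs_def)
  then show "l (tensor_incl scale \<iota> v) = 0"
    using corresponds_quotient[OF f corr w, of v] local_hom_eq_0[OF f _ v] by simp
next
  assume 0: "l (tensor_incl scale \<iota> v) = 0"
  show "sym_incl scale v \<in> p"
  proof (rule ccontr)
    assume "sym_incl scale v \<notin> p"
    \<comment> \<open>With \<open>v\<close> as denominator, every value of \<open>l\<close> on
      \<open>V\<close> becomes a multiple of \<open>l v = 0\<close>.\<close>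
    from corresponds_quotient[OF f corr this]
    have "l (tensor_incl scale \<iota> w) = 0" for w
      using 0 by simp
    then have "l ` carrier (tensor_module scale \<iota>) \<subseteq> {0}"
      using linear_form_zero_on_pure_tensors[OF l] by blast
    with surj show False
      by (metis UNIV_I singletonD subsetD zero_neq_one)
  qed
qed

section \<open>Linear ideals inside a prime, and the resulting description of the strata\<close>

lemma linear_ideal_subset_iff:
  assumes "ideal p (Sym scale)"
  shows "linear_ideal scale W \<subseteq> p \<longleftrightarrow> sym_incl scale ` W \<subseteq> p"
  unfolding linear_ideal_def
  by (rule ring.Idl_subset_ideal[OF cring.axioms(1)[OF cring_Sym] assms])
    (auto simp: sym_incl_def sym_class_carrier)

text \<open>The vectors lying in \<open>p\<close> must form a subspace to compete with the subspaces
  \<open>W\<close> excluded from a stratum. Closure comes from the defining relations of the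
  symmetric algebra.\<close>

lemma subspace_sym_incl_vimage:
  assumes V: "vector_space scale" and p: "ideal p (Sym scale)"
  shows "Modules.module.subspace scale (sym_incl scale -` p)"
proof -
  interpret vector_space scale by (rule V)
  interpret p: ideal p "Sym scale" by (rule p)
  have scale: "sym_incl scale v \<in> p \<Longrightarrow> sym_incl scale (scale c v) \<in> p" for c v
    unfolding sym_incl_scale sym_const_def by (intro p.I_l_closed sym_class_carrier)
  have zero: "sym_incl scale 0 \<in> p"
  proof -
    \<comment> \<open>An element equal to its own double is zero.\<close>
    have "sym_incl scale 0 \<oplus>\<^bsub>Sym scale\<^esub> sym_incl scale 0 = sym_incl scale 0"
      by (simp flip: sym_incl_add)
    then have "sym_incl scale 0 = \<zero>\<^bsub>Sym scale\<^esub>"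
      using p.add.l_cancel_one sym_class_carrier unfolding sym_incl_def by blast
    then show ?thesis by simp
  qed
  show ?thesis
    by (rule subspaceI) (auto simp: zero scale sym_incl_add)
qed

lemma stratum_points_iff:
  fixes scale :: "'k::field \<Rightarrow> 'v::ab_group_add \<Rightarrow> 'v" and \<iota> :: "'k \<Rightarrow> 'K::field"
  assumes V: "vector_space scale" and f: "(p, \<phi>) \<in> PV_points scale \<iota>"
  shows "(p, \<phi>) \<in> stratum_points scale \<iota> V' \<longleftrightarrow> sym_incl scale -` p = V'"
proof -
  let ?V0 = "sym_incl scale -` p"
  have pProj: "p \<in> Proj (Sym scale) (sym_grade scale)"
    using f by (auto simp: PV_points_def Proj_points_def)
  then have p: "ideal p (Sym scale)" "\<not> irrelevant_ideal (Sym scale) (sym_grade scale) \<subseteq> p"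
    by (auto simp: Proj_def primeideal.axioms)
  have vl: "p \<in> vanishing_locus (Sym scale) (sym_grade scale) (linear_ideal scale W) \<longleftrightarrow> W \<subseteq> ?V0" for W
    using pProj linear_ideal_subset_iff[OF p(1), of W]
    by (auto simp: vanishing_locus_def)
  have closed: "(p, \<phi>) \<in> closed_subscheme_points (Sym scale) (sym_grade scale) (sym_const scale) \<iota>
      (linear_ideal scale V') \<longleftrightarrow> V' \<subseteq> ?V0"
    using f vl[of V'] local_hom_eq_0[OF f]
    by (auto simp: closed_subscheme_points_def PV_points_def vanishing_locus_def)
  have sub: "Modules.module.subspace scale ?V0"
    by (rule subspace_sym_incl_vimage[OF V p(1)])
  \<comment> \<open>Being proper, \<open>?V0\<close> is itself an excluded \<open>W\<close> as soon
    as it strictly contains \<open>V'\<close>. Conversely, when \<open>?V0 = V'\<close>, no strictly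
    larger \<open>W\<close> fits inside it.\<close>
  have "?V0 \<noteq> UNIV"
    using irrelevant_ideal_subset[OF p(1)] p(2) by blast
  with sub show ?thesis
    by (auto simp: stratum_points_def closed vl)
qed

theorem lemma3p8:
  fixes scale :: "'k::{field,finite} \<Rightarrow> 'v::ab_group_add \<Rightarrow> 'v"
    and \<iota> :: "'k \<Rightarrow> 'K::alg_closed_field"
    and n :: nat
    and f :: "((('v \<Rightarrow>\<^sub>0 nat) \<Rightarrow>\<^sub>0 'k) set, 'K) geom_point"
    and l :: "('v \<Rightarrow>\<^sub>0 'K) set \<Rightarrow> 'K"
    and V' :: "'v set"
  assumes "vector_space scale"
    and "vector_space.dim scale (UNIV :: 'v set) = n + 1"
    and "n + 1 \<ge> 2"
    and "alg_closure_of \<iota>"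
    and "f \<in> PV_points scale \<iota>"
    and "linear_form (tensor_module scale \<iota>) l"
    and "l ` carrier (tensor_module scale \<iota>) = UNIV"
    and "corresponds scale \<iota> f l"
    and "Modules.module.subspace scale V'"
    and "V' \<noteq> UNIV"
  shows "f \<in> stratum_points scale \<iota> V' \<longleftrightarrow>
    {x \<in> carrier (tensor_module scale \<iota>). l x = 0} \<inter> range (tensor_incl scale \<iota>)
      = tensor_incl scale \<iota> ` V'"
proof -
  obtain p \<phi> where f: "f = (p, \<phi>)"
    by (cases f)
  have inj: "inj (tensor_incl scale \<iota>)"
    using assms(1,4) by (intro inj_tensor_incl) (auto simp: alg_closure_of_def)
  have "{x \<in> carrier (tensor_module scale \<iota>). l x = 0} \<inter> range (tensor_incl scale \<iota>) =
      tensor_incl scale \<iota> ` (sym_incl scale -` p)"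
    using sym_incl_mem_iff[OF assms(5,8)[unfolded f] assms(6,7)] tensor_incl_carrier[of scale \<iota>]
    by auto
  \<comment> \<open>Both sides now say that the vectors in \<open>p\<close> are exactly those of
    \<open>V'\<close>, the right side by injectivity of \<open>tensor_incl\<close>.\<close>
  then show ?thesis
    using stratum_points_iff[OF assms(1) assms(5)[unfolded f], of V'] inj_image_eq_iff[OF inj]
    by (simp add: f)
qed

end
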